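(* Let $n\ge 3$. For all integers $0\le m\le k\le n-1$, the invariant complex moment $J_{k,m}$ of poristic Steiner $n$-chains is algebraically dependent with the first two bending moments $I_1,I_2$: regarding these quantities as functions of the gauge $(R,r,d)$ of the parent circles, there is a nonzero polynomial $P(X,Y,Z)$ with real coefficients such that $P(I_1,I_2,J_{k,m})=0$ for all pairs of parent circles of order $n$.
   Context: Let $q=\tan^2(\pi/n)$. A pair of parent circles of order $n$ with the gauge $(R,r,d)$ consists of a circle $\Gamma$ of radius $R$ and a circle $\gamma$ of radius $r<R$ contained in the open disk bounded by $\Gamma$, with distance $d$ between their centers, where $R,r,d>0$ and $d^2=(R-r)^2-4qRr$. A Steiner $n$-chain with these parent circles is a sequence of circles $\delta_1,\dots,\delta_n$, going once around $\gamma$, such that circles with cyclically adjacent indices are externally tangent and each $\delta_i$ is externally tangent to $\gamma$ and internally tangent to $\Gamma$; under the relation $d^2=(R-r)^2-4qRr$ there is a one-parameter family of such chains (poristic Steiner $n$-chains). Canonical coordinate system: the origin is the center of $\Gamma$ and the $Ox$-axis is the line through the centers of $\Gamma$ and $\gamma$, oriented so that the center of $\gamma$ is the point $(d,0)$; the plane is identified with $\mathbb{C}$ by these coordinates. Moments: if $\delta_i$ has curvature (reciprocal of radius) $b_i>0$ and center $z_i\in\mathbb{C}$ in canonical coordinates, the complex moments are $J_{k,m}=\sum_{i=1}^n b_i^k z_i^m$, and the bending moments are $I_k=J_{k,0}=\sum_{i=1}^n b_i^k$. For $0\le m\le k\le n-1$ the quantities $J_{k,m}$ do not depend on the choice of the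 chain with the given parent circles (invariant complex moments), so they are functions of the gauge $(R,r,d)$. *)

theory Defs
  imports "HOL-Analysis.Analysis" "HOL-Computational_Algebra.Polynomial"
begin

text \<open>A circle in the complex plane, given as (centre, radius).\<close>

type_synonym circle = "complex \<times> real"

abbreviation centre :: "circle \<Rightarrow> complex" where "centre \<equiv> fst"
abbreviation radius :: "circle \<Rightarrow> real" where "radius \<equiv> snd"

definition curvature :: "circle \<Rightarrow> real" where
  "curvature C = 1 / radius C"

definition externally_tangent :: "circle \<Rightarrow> circle \<Rightarrow> bool" where
  "externally_tangent C D \<longleftrightarrow> dist (centre C) (centre D) = radius C + radius D"

text \<open>The first circle is the inner one.\<close>

definition internally_tangent :: "circle \<Rightarrow> circle \<Rightarrow> bool" where
  "internally_tangent C D \<longleftrightarrow>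
     radius C < radius D \<and> dist (centre C) (centre D) = radius D - radius C"

text \<open>The two parent circles in canonical coordinates.\<close>

definition outer_parent :: "real \<Rightarrow> circle" where
  "outer_parent R = (0, R)"

definition inner_parent :: "real \<Rightarrow> real \<Rightarrow> circle" where
  "inner_parent r d = (complex_of_real d, r)"

definition parent_gauge :: "nat \<Rightarrow> real \<Rightarrow> real \<Rightarrow> real \<Rightarrow> bool" where
  "parent_gauge n R r d \<longleftrightarrow>
     0 < R \<and> 0 < r \<and> 0 < d \<and> r < R \<and>
     cball (centre (inner_parent r d)) (radius (inner_parent r d))
       \<subseteq> ball (centre (outer_parent R)) (radius (outer_parent R)) \<and>
     d\<^sup>2 = (R - r)\<^sup>2 - 4 * (tan (pi / real n))\<^sup>2 * R * r"

text \<open>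
  The closed polygon through the points \<open>z 0, \<dots>, z (n - 1)\<close> winds exactly once, in
  either direction, around \<open>c\<close>: the signed angles, taken in \<open>(-\<pi>, \<pi>]\<close>, under which
  its edges are seen from \<open>c\<close> add up to a full turn.
\<close>

definition winds_once_around :: "nat \<Rightarrow> (nat \<Rightarrow> complex) \<Rightarrow> complex \<Rightarrow> bool" where
  "winds_once_around n z c \<longleftrightarrow>
     \<bar>\<Sum>i<n. Arg ((z (Suc i mod n) - c) / (z i - c))\<bar> = 2 * pi"

text \<open>
  The circles of a chain are indexed by \<open>0, \<dots>, n - 1\<close>; values of \<open>\<delta>\<close> at other indices
  are irrelevant.  Winding once excludes sequences that double back, such as
  \<open>\<delta> 0, \<delta> 1, \<delta> 0, \<delta> 1\<close>, which the tangency conditions alone would admit.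
\<close>

definition steiner_chain :: "nat \<Rightarrow> circle \<Rightarrow> circle \<Rightarrow> (nat \<Rightarrow> circle) \<Rightarrow> bool" where
  "steiner_chain n \<Gamma> \<gamma> \<delta> \<longleftrightarrow>
     (\<forall>i<n. 0 < radius (\<delta> i) \<and>
            externally_tangent (\<delta> i) \<gamma> \<and>
            internally_tangent (\<delta> i) \<Gamma> \<and>
            externally_tangent (\<delta> i) (\<delta> (Suc i mod n))) \<and>
     winds_once_around n (\<lambda>i. centre (\<delta> i)) (centre \<gamma>)"

definition complex_moment :: "nat \<Rightarrow> nat \<Rightarrow> nat \<Rightarrow> (nat \<Rightarrow> circle) \<Rightarrow> complex" where
  "complex_moment n k m \<delta> =
     (\<Sum>i<n. complex_of_real (curvature (\<delta> i)) ^ k * centre (\<delta> i) ^ m)"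

definition bending_moment :: "nat \<Rightarrow> nat \<Rightarrow> (nat \<Rightarrow> circle) \<Rightarrow> complex" where
  "bending_moment n k \<delta> = complex_moment n k 0 \<delta>"

text \<open>
  Polynomials in \<open>X, Y, Z\<close> are elements of \<open>\<real>[X][Y][Z]\<close>: the innermost variable is
  \<open>X\<close>, the outermost one is \<open>Z\<close>.  They are evaluated at complex arguments.
\<close>

definition poly3 ::
  "real poly poly poly \<Rightarrow> complex \<Rightarrow> complex \<Rightarrow> complex \<Rightarrow> complex" where
  "poly3 P x y z =
     poly (map_poly (\<lambda>Q. poly (map_poly (\<lambda>S. poly (map_poly complex_of_real S) x) Q) y) P) z"

end

theory Submission
  imports Defs
begin

text \<open>
  For a circle of curvature \<open>b\<close> and centre \<open>z\<close> inside \<open>\<Gamma>\<close>, tangency to \<open>\<Gamma>\<close> says that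
  \<open>(R b - 1, b z)\<close> is a null vector of Lorentzian 3-space, and tangency to \<open>\<gamma>\<close> puts it on a
  fixed plane.  The resulting conic is parametrised by an angle \<open>\<theta>\<close> so that \<open>b\<close> and \<open>b z\<close>
  are trigonometric polynomials of degree 1, and by the gauge relation two such circles are
  tangent iff their angles differ by \<open>\<plusminus>2\<pi>/n\<close>.  A chain winding once therefore has equally
  spaced angles, so the sum of \<open>b^k z^m = b^(k-m) (b z)^m\<close>, of degree \<open>k < n\<close> in \<open>e^(i\<theta>)\<close>,
  is \<open>n\<close> times its constant coefficient.

  With \<open>t = (R - d)/r\<close> the gauge relation becomes \<open>2 h R/r = t^2 - 1\<close> for \<open>h = t - 1 - 2q\<close>,
  whence \<open>J_(k,m) R^(k-m) h^k\<close> is a polynomial in \<open>t\<close> alone.  Among the monomials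
  \<open>I_1^i I_2^j J_(k,m)^l\<close> of a fixed degree \<open>i + 2j + (k-m)l\<close> in \<open>1/R\<close> there are about
  \<open>N^2\<close> with \<open>j, l \<le> N\<close>, while the corresponding polynomials in \<open>t\<close> have degree \<open>O(N)\<close>;
  hence they are linearly dependent for large \<open>N\<close>.
\<close>

section \<open>Tangency to the parent circles in terms of an angle\<close>

text \<open>The two distance equations differ by an equation linear in \<open>Re z\<close>, so
  \<open>1 / \<rho>\<close> and \<open>Re z / \<rho>\<close> are affine in one parameter
  \<open>C\<close>; the outer tangency then becomes the unit circle equation for \<open>C\<close>
  and \<open>S\<close>.\<close>

lemma circle_between_parents:
  fixes R r d q s \<rho> :: real and z :: complex
  assumes pos: "0 < R" "0 < r" "0 < d" "0 < q" "0 < s" "0 < \<rho>"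
    and s: "s\<^sup>2 = (1 + q) / q"
    and gauge: "d\<^sup>2 = (R - r)\<^sup>2 - 4 * q * R * r"
    and outer: "cmod z = R - \<rho>" and inner: "cmod (z - of_real d) = \<rho> + r"
  obtains C S where "C\<^sup>2 + S\<^sup>2 = 1"
    and "1 / \<rho> = (R - r + d * C) / (2 * q * r * R)"
    and "1 / \<rho> * Re z = (d + (R - r - 2 * q * r) * C) / (2 * q * r)"
    and "1 / \<rho> * Im z = s * S"
proof -
  define b where "b = 1 / \<rho>"
  define \<kappa> where "\<kappa> = R - r - 2 * q * r"
  \<comment> \<open>\<open>C\<close> and \<open>S\<close> are obtained by solving the first and the
    third formula of the conclusion.\<close>
  define C where "C = (2 * q * r * R * b - (R - r)) / d"
  define S where "S = b * Im z / s"
  have b\<rho>: "b * \<rho> = 1" using pos by (simp add: b_def)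
  have e1: "(Re z)\<^sup>2 + (Im z)\<^sup>2 = (R - \<rho>)\<^sup>2"
    using outer cmod_power2 by metis
  have e2: "(Re z - d)\<^sup>2 + (Im z)\<^sup>2 = (\<rho> + r)\<^sup>2"
    using inner cmod_power2[of "z - of_real d"] by simp
  have lin: "2 * d * Re z = d\<^sup>2 + (R - \<rho>)\<^sup>2 - (\<rho> + r)\<^sup>2"
    using e1 e2 by (simp add: power2_eq_square algebra_simps)
  have bC: "2 * q * r * R * b = R - r + d * C"
    using pos by (simp add: C_def)
  \<comment> \<open>The gauge relation is used to reach a form in which multiplication by
    \<open>b\<close> leaves \<open>\<rho>\<close> only inside \<open>b * \<rho> = 1\<close>.\<close>
  have "2 * q * r * (d * Re z) = \<rho> * d\<^sup>2 + \<kappa> * (2 * q * r * R - (R - r) * \<rho>)"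
  proof -
    have "2 * q * r * (d * Re z) = q * r * (d\<^sup>2 + (R - \<rho>)\<^sup>2 - (\<rho> + r)\<^sup>2)"
      unfolding lin[symmetric] by simp
    also have "\<dots> = \<rho> * d\<^sup>2 + \<kappa> * (2 * q * r * R - (R - r) * \<rho>)"
      unfolding gauge \<kappa>_def by (simp add: power2_eq_square algebra_simps)
    finally show ?thesis .
  qed
  then have "b * (2 * q * r * (d * Re z))
      = b * (\<rho> * d\<^sup>2 + \<kappa> * (2 * q * r * R - (R - r) * \<rho>))"
    by (rule arg_cong)
  also have "\<dots> = (b * \<rho>) * d\<^sup>2 + \<kappa> * (2 * q * r * R * b - (R - r) * (b * \<rho>))"
    by (simp add: algebra_simps)
  finally have "b * (2 * q * r * (d * Re z))
      = (b * \<rho>) * d\<^sup>2 + \<kappa> * (2 * q * r * R * b - (R - r) * (b * \<rho>))" .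
  then have "b * (2 * q * r * (d * Re z)) = d\<^sup>2 + \<kappa> * (d * C)"
    unfolding b\<rho> using bC by simp
  then have "d * (2 * q * r * (b * Re z)) = d * (d + \<kappa> * C)"
    by (simp add: power2_eq_square algebra_simps)
  then have bx: "2 * q * r * (b * Re z) = d + \<kappa> * C"
    using pos by simp
  have u: "2 * q * r * (R * b - 1) = \<kappa> + d * C"
    using bC by (simp add: \<kappa>_def algebra_simps)
  have by2: "(b * Im z)\<^sup>2 = (R * b - 1)\<^sup>2 - (b * Re z)\<^sup>2"
  proof -
    have "(b * Im z)\<^sup>2 + (b * Re z)\<^sup>2 = b\<^sup>2 * (R - \<rho>)\<^sup>2"
      unfolding e1[symmetric] by (simp add: power2_eq_square algebra_simps)
    also have "\<dots> = (R * b - b * \<rho>)\<^sup>2"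
      by (simp add: power2_eq_square algebra_simps)
    finally show ?thesis using b\<rho> by simp
  qed
  have \<kappa>d: "\<kappa>\<^sup>2 - d\<^sup>2 = 4 * q * (1 + q) * r\<^sup>2"
    unfolding gauge \<kappa>_def by (simp add: power2_eq_square algebra_simps)
  \<comment> \<open>This is the null vector equation scaled by \<open>2 q r\<close>. The mixed terms
    \<open>2 \<kappa> d C\<close> cancel, and by the gauge relation the factor
    \<open>\<kappa>^2 - d^2\<close> is \<open>(2 q r s)^2\<close>.\<close>
  have "(2 * q * r)\<^sup>2 * (b * Im z)\<^sup>2 = (\<kappa> + d * C)\<^sup>2 - (d + \<kappa> * C)\<^sup>2"
    unfolding by2 u[symmetric] bx[symmetric] by (simp add: power2_eq_square algebra_simps)
  also have "\<dots> = (\<kappa>\<^sup>2 - d\<^sup>2) * (1 - C\<^sup>2)"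
    by (simp add: power2_eq_square algebra_simps)
  also have "\<dots> = (2 * q * r)\<^sup>2 * (s\<^sup>2 * (1 - C\<^sup>2))"
    unfolding \<kappa>d s using pos by (simp add: power2_eq_square)
  finally have "(b * Im z)\<^sup>2 = s\<^sup>2 * (1 - C\<^sup>2)"
    using pos by simp
  then have "S\<^sup>2 = 1 - C\<^sup>2"
    using pos by (simp add: S_def power_divide)
  moreover have "b = (R - r + d * C) / (2 * q * r * R)"
    using bC pos by (simp add: field_simps)
  moreover have "b * Re z = (d + \<kappa> * C) / (2 * q * r)"
    using bx pos by (simp add: field_simps)
  moreover have "b * Im z = s * S"
    using pos by (simp add: S_def)
  ultimately show thesis
    using that[of C S] by (simp add: b_def \<kappa>_def)
qed

text \<open>By polarisation of the null cone, external tangency says that the Lorentz product of the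
  two vectors \<open>(R b - 1, b z)\<close> is 2. In angle coordinates this product is
  \<open>s^2 (1 - c)\<close> with \<open>c\<close> the cosine of the angle difference, so
  \<open>c = 1 - 2 / s^2\<close>.\<close>

lemma tangent_circles_angle:
  fixes R r d q s \<rho> \<rho>' C S C' S' :: real and z z' :: complex
  assumes pos: "0 < R" "0 < r" "0 < q" "0 < \<rho>" "0 < \<rho>'"
    and s: "s\<^sup>2 = (1 + q) / q"
    and gauge: "d\<^sup>2 = (R - r)\<^sup>2 - 4 * q * R * r"
    and outer: "cmod z = R - \<rho>" "cmod z' = R - \<rho>'"
    and tangent: "cmod (z - z') = \<rho> + \<rho>'"
    and b: "1 / \<rho> = (R - r + d * C) / (2 * q * r * R)"
      "1 / \<rho>' = (R - r + d * C') / (2 * q * r * R)"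
    and x: "1 / \<rho> * Re z = (d + (R - r - 2 * q * r) * C) / (2 * q * r)"
      "1 / \<rho>' * Re z' = (d + (R - r - 2 * q * r) * C') / (2 * q * r)"
    and y: "1 / \<rho> * Im z = s * S" "1 / \<rho>' * Im z' = s * S'"
  shows "C * C' + S * S' = (1 - q) / (1 + q)"
proof -
  define \<kappa> where "\<kappa> = R - r - 2 * q * r"
  define B where "B = 1 / \<rho>"
  define B' where "B' = 1 / \<rho>'"
  have B\<rho>: "B * \<rho> = 1" "B' * \<rho>' = 1" using pos by (auto simp: B_def B'_def)
  have n1: "(Re z)\<^sup>2 + (Im z)\<^sup>2 = (R - \<rho>)\<^sup>2" "(Re z')\<^sup>2 + (Im z')\<^sup>2 = (R - \<rho>')\<^sup>2"
    using outer cmod_power2 by metis+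
  have n2: "(Re z - Re z')\<^sup>2 + (Im z - Im z')\<^sup>2 = (\<rho> + \<rho>')\<^sup>2"
    using tangent cmod_power2[of "z - z'"] by simp
  have "(R - \<rho>) * (R - \<rho>') - (Re z * Re z' + Im z * Im z') = 2 * \<rho> * \<rho>'"
    using n1 n2 by (simp add: power2_eq_square algebra_simps)
  then have "B * B' * ((R - \<rho>) * (R - \<rho>') - (Re z * Re z' + Im z * Im z'))
      = 2 * (B * \<rho>) * (B' * \<rho>')"
    by simp
  then have "(R * B - B * \<rho>) * (R * B' - B' * \<rho>')
      - ((B * Re z) * (B' * Re z') + (B * Im z) * (B' * Im z')) = 2 * (B * \<rho>) * (B' * \<rho>')"
    by (simp add: algebra_simps)
  then have lorentz: "(R * B - 1) * (R * B' - 1)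
      - ((B * Re z) * (B' * Re z') + (s * S) * (s * S')) = 2"
    unfolding B\<rho> y[folded B_def B'_def] by simp
  define g where "g = 2 * q * r"
  have g: "g > 0" using pos by (simp add: g_def)
  have u: "g * (R * B - 1) = \<kappa> + d * C" "g * (R * B' - 1) = \<kappa> + d * C'"
    using b pos unfolding B_def B'_def \<kappa>_def g_def by (auto simp: field_simps)
  have x': "g * (B * Re z) = d + \<kappa> * C" "g * (B' * Re z') = d + \<kappa> * C'"
    using x pos unfolding B_def[symmetric] B'_def[symmetric] \<kappa>_def g_def
    by (auto simp: field_simps)
  have \<kappa>d: "\<kappa>\<^sup>2 - d\<^sup>2 = g\<^sup>2 * s\<^sup>2"
    unfolding gauge \<kappa>_def g_def s using pos by (simp add: power2_eq_square field_simps)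
  have "g\<^sup>2 * 2 = (g * (R * B - 1)) * (g * (R * B' - 1))
      - ((g * (B * Re z)) * (g * (B' * Re z')) + g\<^sup>2 * s\<^sup>2 * (S * S'))"
    unfolding lorentz[symmetric] by (simp add: power2_eq_square algebra_simps)
  also have "\<dots> = (\<kappa>\<^sup>2 - d\<^sup>2) * (1 - C * C') - g\<^sup>2 * s\<^sup>2 * (S * S')"
    unfolding u x' by (simp add: power2_eq_square algebra_simps)
  finally have "g\<^sup>2 * 2 = g\<^sup>2 * (s\<^sup>2 * (1 - (C * C' + S * S')))"
    unfolding \<kappa>d by (simp add: algebra_simps)
  then have "2 = s\<^sup>2 * (1 - (C * C' + S * S'))"
    using g by simp
  then have "2 = (1 + q) / q * (1 - (C * C' + S * S'))"
    unfolding s .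
  then show ?thesis using pos by (simp add: field_simps)
qed

section \<open>Closed walks on roots of unity\<close>

lemma unit_complex_eq_cis:
  assumes "cmod z = 1" and "Re z = cos a"
  shows "z = cis a \<or> z = inverse (cis a)"
proof -
  have "(Re z)\<^sup>2 + (Im z)\<^sup>2 = 1" using assms(1) cmod_power2[of z] by simp
  then have "(Im z)\<^sup>2 = (sin a)\<^sup>2"
    unfolding assms(2) using sin_squared_eq[of a] by simp
  then have "Im z = sin a \<or> Im z = - sin a" by (simp add: power2_eq_iff)
  then show ?thesis using assms(2) by (auto simp: complex_eq_iff cis_cnj[symmetric] cis_inverse)
qed

text \<open>Inversion negates the argument except on the negative real axis, where both arguments
  are \<open>pi\<close>.\<close>

lemma Arg_divide_antisym:
  assumes "Arg (w / z) \<noteq> pi"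
  shows "Arg (w / z) = - Arg (z / w)"
proof -
  have "Arg (inverse u) = - Arg u" if "Arg u \<noteq> pi" for u
    using that Arg_eq_0_pi[of u] by (auto simp: Arg_inverse)
  from this[OF assms] show ?thesis by simp
qed

text \<open>A negative quotient means that 0 lies on the segment from \<open>w\<close> to
  \<open>z\<close>.\<close>

lemma Arg_eq_pi_imp_norm_diff:
  assumes "Arg (w / z) = pi" "z \<noteq> 0"
  shows "cmod (w - z) = cmod w + cmod z"
proof -
  define l where "l = w / z"
  have "Re l < 0" "Im l = 0" using assms(1) by (auto simp: l_def[symmetric] Arg_eq_pi)
  then have l: "l = of_real (Re l)" by (simp add: complex_eq_iff)
  have w: "w = of_real (Re l) * z" using assms(2) l by (simp add: l_def)
  have "w - z = of_real (Re l - 1) * z" by (subst w) (simp add: algebra_simps)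
  then have "cmod (w - z) = \<bar>Re l - 1\<bar> * cmod z" by (simp only: norm_mult norm_of_real)
  moreover have "cmod w = \<bar>Re l\<bar> * cmod z" by (subst w) (simp only: norm_mult norm_of_real)
  ultimately show ?thesis using \<open>Re l < 0\<close> by (simp add: algebra_simps)
qed

text \<open>Each step multiplies by a primitive \<open>n\<close>-th root of unity or by its inverse.
  The walk closes up after \<open>n\<close> steps, so the signs of the steps add up to 0 or
  \<plusminus>n; the sum 0 contradicts the winding, and \<plusminus>n forces all signs to agree.
  \<open>F\<close> maps the unit circle to the points whose winding about 0 is measured.\<close>

lemma walk_around_roots_of_unity:
  fixes \<zeta> :: "nat \<Rightarrow> complex" and F :: "complex \<Rightarrow> complex"
  assumes n: "3 \<le> n"
    and unit: "\<And>i. i < n \<Longrightarrow> cmod (\<zeta> i) = 1"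
    and step: "\<And>i. i < n \<Longrightarrow> Re (\<zeta> (Suc i mod n) * cnj (\<zeta> i)) = cos (2 * pi / n)"
    and not_opposite: "\<And>i. i < n \<Longrightarrow> Arg (F (\<zeta> (Suc i mod n)) / F (\<zeta> i)) \<noteq> pi"
    and winding: "(\<Sum>i<n. Arg (F (\<zeta> (Suc i mod n)) / F (\<zeta> i))) \<noteq> 0"
  obtains \<eta> where "\<eta> ^ n = 1" "\<And>j. 0 < j \<Longrightarrow> j < n \<Longrightarrow> \<eta> ^ j \<noteq> 1"
    "\<And>i. i < n \<Longrightarrow> \<zeta> i = \<zeta> 0 * \<eta> ^ i"
proof -
  define \<omega> where "\<omega> = cis (2 * pi / n)"
  define Z where "Z i = \<zeta> (i mod n)" for i
  have \<omega>0: "\<omega> \<noteq> 0" by (simp add: \<omega>_def)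
  have \<omega>n: "\<omega> ^ n = 1" using n by (simp add: \<omega>_def Complex.DeMoivre)
  have prim: "\<omega> ^ j \<noteq> 1" if "0 < j" "j < n" for j
  proof
    assume "\<omega> ^ j = 1"
    then have "cis (2 * pi * (j / n)) = 1" by (simp add: \<omega>_def Complex.DeMoivre mult.commute)
    then have "cos (2 * pi * (j / n)) = 1" by (simp add: complex_eq_iff)
    then obtain a :: int where "2 * pi * (j / n) = of_int a * 2 * pi"
      using cos_one_2pi_int by auto
    then have "2 * pi * (real j / n) = 2 * pi * of_int a" by (simp only: mult_ac)
    then have "real j / n = of_int a" by (simp only: mult_cancel_left) simp
    moreover have "0 < real j / n" "real j / n < 1" using that by auto
    ultimately have "0 < a" "a < 1" by auto
    then show False by simp
  qed
  have Z_unit: "cmod (Z i) = 1" for i using unit n by (simp add: Z_def)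
  then have Z0: "Z i \<noteq> 0" for i by (metis norm_zero zero_neq_one)
  have ratio: "Z (Suc i) = Z i * \<omega> \<or> Z (Suc i) = Z i * inverse \<omega>" if "i < n" for i
  proof -
    define x where "x = Z (Suc i) * cnj (Z i)"
    have "cmod x = 1" by (simp add: x_def norm_mult Z_unit)
    moreover have "Re x = cos (2 * pi / n)" using step[OF that] that by (simp add: x_def Z_def)
    ultimately have "x = \<omega> \<or> x = inverse \<omega>" unfolding \<omega>_def by (rule unit_complex_eq_cis)
    moreover have "Z i * x = Z (Suc i)"
    proof -
      have "Z i * cnj (Z i) = 1" by (simp add: complex_norm_square[symmetric] Z_unit)
      then have "Z i * x = Z (Suc i) * 1" unfolding x_def by (metis mult.left_commute)
      then show ?thesis by simp
    qed
    ultimately show ?thesis by metis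
  qed
  define \<epsilon> :: "nat \<Rightarrow> int" where "\<epsilon> i = (if Z (Suc i) = Z i * \<omega> then 1 else -1)" for i
  \<comment> \<open>\<open>e i\<close> is the position on the unrolled cycle after \<open>i\<close>
    steps.\<close>
  define e where "e i = (\<Sum>j<i. \<epsilon> j)" for i
  have e_Suc: "e (Suc i) = e i + \<epsilon> i" for i by (simp add: e_def)
  have \<epsilon>: "\<epsilon> i = 1 \<or> \<epsilon> i = -1" for i by (simp add: \<epsilon>_def)
  have Ze: "Z i = Z 0 * \<omega> powi e i" if "i \<le> n" for i
    using that
  proof (induction i)
    case 0
    then show ?case by (simp add: e_def)
  next
    case (Suc i)
    have "Z (Suc i) = Z i * \<omega> powi \<epsilon> i"
      using ratio[of i] Suc.prems by (auto simp: \<epsilon>_def power_int_minus)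
    then show ?case using Suc \<omega>0 by (simp add: e_Suc power_int_add)
  qed
  have bound: "\<bar>e j - e i\<bar> \<le> int j - int i" if "i \<le> j" for i j
    using that
  proof (induction j rule: dec_induct)
    case base
    then show ?case by simp
  next
    case (step j)
    then show ?case using \<epsilon>[of j] by (auto simp: e_Suc)
  qed
  have "Z n = Z 0" by (simp add: Z_def)
  then have "\<omega> powi e n = 1" using Ze[of n] Z0[of 0] by auto
  then have root: "\<omega> ^ nat \<bar>e n\<bar> = 1"
    by (cases "e n \<ge> 0") (auto simp: power_int_def power_inverse)
  have e0: "e 0 = 0" by (simp add: e_def)
  have "\<bar>e n\<bar> \<le> int n" using bound[of 0 n] e0 by simp
  \<comment> \<open>No positive exponent below \<open>n\<close>, the order of
    \<open>\<omega>\<close>, gives 1.\<close>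
  then have "nat \<bar>e n\<bar> = 0 \<or> nat \<bar>e n\<bar> = n"
    using prim[of "nat \<bar>e n\<bar>"] root by (cases "nat \<bar>e n\<bar> < n") auto
  then have "e n = 0 \<or> e n = int n \<or> e n = - int n" by auto
  moreover have "e n \<noteq> 0"
    \<comment> \<open>The signed angles are increments of a function of the position on the unrolled cycle,
      so for a walk that returns to its starting position they cancel.\<close>
  proof
    assume "e n = 0"
    define V where "V x = F (Z 0 * \<omega> powi x)" for x
    define a where "a x = Arg (V (x + 1) / V x)" for x
    \<comment> \<open>\<open>\<Phi>\<close> is a discrete primitive of \<open>a\<close>. It starts
      at \<open>- int n\<close>, below which \<open>n\<close> steps from 0 cannot lead.\<close>
    define \<Phi> where "\<Phi> x = (\<Sum>j\<in>{- int n..<x}. a j)" for x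
    have \<Phi>: "\<Phi> (x + 1) = \<Phi> x + a x" if "x \<ge> - int n" for x
    proof -
      have "{- int n..<x + 1} = insert x {- int n..<x}" using that by auto
      then show ?thesis by (simp add: \<Phi>_def)
    qed
    have telescope: "Arg (F (\<zeta> (Suc i mod n)) / F (\<zeta> i)) = \<Phi> (e (Suc i)) - \<Phi> (e i)"
      if i: "i < n" for i
    proof -
      have F: "F (\<zeta> (Suc i mod n)) = V (e (Suc i))" "F (\<zeta> i) = V (e i)"
        using Ze[of i] Ze[of "Suc i"] i by (simp_all add: V_def Z_def)
      have lb: "e i \<ge> - int n" "e (Suc i) \<ge> - int n"
        using bound[of 0 i] bound[of 0 "Suc i"] i e0 by auto
      have anti: "Arg (V (e (Suc i)) / V (e i)) = - Arg (V (e i) / V (e (Suc i)))"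
        using Arg_divide_antisym not_opposite[OF i] unfolding F by blast
      show ?thesis
      proof (cases "\<epsilon> i = 1")
        case True
        then show ?thesis unfolding F using \<Phi>[OF lb(1)] by (simp add: e_Suc a_def)
      next
        case False
        \<comment> \<open>A backward step runs through the edge that starts at
          \<open>e (Suc i)\<close> in reverse, so antisymmetry of the argument supplies the
          sign.\<close>
        then have "e i = e (Suc i) + 1" using \<epsilon>[of i] by (simp add: e_Suc)
        then show ?thesis
          unfolding F anti using \<Phi>[OF lb(2)] by (simp add: a_def)
      qed
    qed
    have "(\<Sum>i<n. Arg (F (\<zeta> (Suc i mod n)) / F (\<zeta> i)))
        = (\<Sum>i<n. \<Phi> (e (Suc i)) - \<Phi> (e i))"
      by (rule sum.cong[OF refl], rule telescope) simp
    also have "\<dots> = \<Phi> (e n) - \<Phi> (e 0)" by (rule sum_lessThan_telescope)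
    finally have "(\<Sum>i<n. Arg (F (\<zeta> (Suc i mod n)) / F (\<zeta> i))) = \<Phi> (e n) - \<Phi> (e 0)" .
    then show False using winding \<open>e n = 0\<close> e0 by simp
  qed
  ultimately consider "e n = int n" | "e n = - int n" by auto
  then show thesis
  proof cases
    case 1
    have "\<zeta> i = \<zeta> 0 * \<omega> ^ i" if "i < n" for i
    proof -
      \<comment> \<open>The first \<open>i\<close> steps gain at most \<open>i\<close> and the
        others at most \<open>n - i\<close>, so a total of \<open>n\<close> leaves no slack.\<close>
      have "e i = int i" using bound[of i n] bound[of 0 i] 1 e0 that by simp
      then show ?thesis using Ze[of i] that by (simp add: Z_def)
    qed
    then show thesis using that[of \<omega>] \<omega>n prim by blast
  next
    case 2
    have "\<zeta> i = \<zeta> 0 * inverse \<omega> ^ i" if "i < n" for i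
    proof -
      have "e i = - int i" using bound[of i n] bound[of 0 i] 2 e0 that by simp
      then show ?thesis using Ze[of i] that
        by (simp add: Z_def power_int_minus power_inverse)
    qed
    moreover have "inverse \<omega> ^ j \<noteq> 1" if "0 < j" "j < n" for j
      using prim[OF that] by (simp add: power_inverse)
    moreover have "inverse \<omega> ^ n = 1" using \<omega>n by (simp add: power_inverse)
    ultimately show thesis using that[of "inverse \<omega>"] by blast
  qed
qed

section \<open>Sums over roots of unity\<close>

text \<open>For a Laurent monomial of exponent \<open>a - k\<close> the sum is geometric with ratio
  \<open>\<eta>^(a - k)\<close>. If the exponent is nonzero, its absolute value is at most
  \<open>k < n\<close>, so the ratio is an \<open>n\<close>-th root of unity other than 1. Summation
  thus extracts constant coefficients.\<close>

lemma sum_laurent_roots_of_unity: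
  fixes \<zeta>0 \<eta> :: complex
  assumes \<eta>: "\<eta> ^ n = 1" and prim: "\<And>j. 0 < j \<Longrightarrow> j < n \<Longrightarrow> \<eta> ^ j \<noteq> 1"
    and \<zeta>0: "\<zeta>0 \<noteq> 0" and k: "k < n" and a: "a \<le> 2 * k"
  shows "(\<Sum>i<n. (\<zeta>0 * \<eta> ^ i) ^ a / (\<zeta>0 * \<eta> ^ i) ^ k) = (if a = k then of_nat n else 0)"
proof -
  have \<eta>0: "\<eta> \<noteq> 0" using \<eta> k by (metis power_0_left not_less_zero zero_neq_one)
  define x where "x = \<eta> ^ a / \<eta> ^ k"
  have "(\<zeta>0 * \<eta> ^ i) ^ a / (\<zeta>0 * \<eta> ^ i) ^ k = \<zeta>0 ^ a / \<zeta>0 ^ k * x ^ i" for i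
    by (simp add: x_def power_mult_distrib power_divide power_mult[symmetric] mult.commute)
  then have sum: "(\<Sum>i<n. (\<zeta>0 * \<eta> ^ i) ^ a / (\<zeta>0 * \<eta> ^ i) ^ k)
      = \<zeta>0 ^ a / \<zeta>0 ^ k * (\<Sum>i<n. x ^ i)"
    by (simp add: sum_distrib_left)
  show ?thesis
  proof (cases "a = k")
    case True
    then show ?thesis using \<zeta>0 \<eta>0 by simp
  next
    case False
    have "x \<noteq> 1"
    proof (cases "k < a")
      case True
      then have "x = \<eta> ^ (a - k)" using \<eta>0 by (simp add: x_def power_diff)
      then show ?thesis using prim[of "a - k"] True a k by simp
    next
      case False
      then have "inverse x = \<eta> ^ (k - a)" using \<eta>0 by (simp add: x_def power_diff)
      moreover have "\<eta> ^ (k - a) \<noteq> 1" using prim[of "k - a"] False \<open>a \<noteq> k\<close> k by simp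
      ultimately show ?thesis by auto
    qed
    moreover have "x ^ n = 1"
    proof -
      have "x ^ n = (\<eta> ^ n) ^ a / (\<eta> ^ n) ^ k"
        by (simp add: x_def power_divide power_mult[symmetric] mult.commute)
      then show ?thesis using \<eta> by simp
    qed
    ultimately have "(\<Sum>i<n. x ^ i) = 0" by (simp add: geometric_sum)
    then show ?thesis using sum False by simp
  qed
qed

section \<open>Linear relations with real coefficients\<close>

text \<open>Gaussian elimination, with equations indexed by \<open>E\<close> and unknowns by
  \<open>S\<close>: an unknown \<open>p\<close> that occurs in equation \<open>e\<close> is
  eliminated from the remaining equations.\<close>

lemma homogeneous_system_nontrivial_solution:
  fixes A :: "'s \<Rightarrow> 'e \<Rightarrow> 'a :: field"
  assumes "finite E" "finite S" "card E < card S"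
  shows "\<exists>c. (\<exists>s\<in>S. c s \<noteq> 0) \<and> (\<forall>e\<in>E. (\<Sum>s\<in>S. c s * A s e) = 0)"
  using assms
proof (induction E arbitrary: S A rule: finite_induct)
  case empty
  then obtain s where "s \<in> S" by fastforce
  then show ?case by (intro exI[of _ "\<lambda>_. 1"]) auto
next
  case (insert e E)
  show ?case
  proof (cases "\<forall>s\<in>S. A s e = 0")
    case True
    have "card E < card S" using insert by simp
    then obtain c where "\<exists>s\<in>S. c s \<noteq> 0" "\<forall>e\<in>E. (\<Sum>s\<in>S. c s * A s e) = 0"
      using insert.IH[OF \<open>finite S\<close>] by blast
    then show ?thesis using True by (intro exI[of _ c]) auto
  next
    case False
    then obtain p where p: "p \<in> S" "A p e \<noteq> 0" by blast
    define S' where "S' = S - {p}"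
    have S': "finite S'" "S = insert p S'" "p \<notin> S'"
      using p insert.prems by (auto simp: S'_def)
    have "card E < card S'" using insert S' by simp
    then obtain c where c: "\<exists>s\<in>S'. c s \<noteq> 0"
      "\<forall>f\<in>E. (\<Sum>s\<in>S'. c s * (A s f - A s e / A p e * A p f)) = 0"
      using insert.IH[OF S'(1), of "\<lambda>s f. A s f - A s e / A p e * A p f"] by blast
    \<comment> \<open>The value at the pivot is the one that solves equation
      \<open>e\<close>.\<close>
    define c' where "c' = c(p := - (\<Sum>s\<in>S'. c s * (A s e / A p e)))"
    have c': "(\<Sum>s\<in>S. c' s * A s f) = (\<Sum>s\<in>S'. c s * (A s f - A s e / A p e * A p f))" for f
    proof -
      have "(\<Sum>s\<in>S. c' s * A s f) = c' p * A p f + (\<Sum>s\<in>S'. c' s * A s f)"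
        using S' by simp
      also have "(\<Sum>s\<in>S'. c' s * A s f) = (\<Sum>s\<in>S'. c s * A s f)"
        using S' by (intro sum.cong) (auto simp: c'_def)
      also have "c' p * A p f = - (\<Sum>s\<in>S'. c s * (A s e / A p e * A p f))"
        by (simp add: c'_def sum_distrib_right mult.assoc)
      finally show ?thesis by (simp add: sum_subtractf algebra_simps)
    qed
    have "\<exists>s\<in>S. c' s \<noteq> 0" using c(1) S' by (auto simp: c'_def)
    moreover have "\<forall>f\<in>insert e E. (\<Sum>s\<in>S. c' s * A s f) = 0"
      unfolding c' using c(2) p(2) by simp
    ultimately show ?thesis by blast
  qed
qed

text \<open>Each of the \<open>D + 1\<close> complex coefficients contributes two real equations,
  one for each of its parts. Real \<open>c\<close> are wanted because they become the coefficients
  of a real polynomial.\<close>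

lemma real_linear_relation_complex_polys:
  fixes F :: "'s \<Rightarrow> complex poly"
  assumes "finite S" and deg: "\<And>s. s \<in> S \<Longrightarrow> degree (F s) \<le> D" and card: "2 * (D + 1) < card S"
  obtains c :: "'s \<Rightarrow> real" where "\<exists>s\<in>S. c s \<noteq> 0"
    and "(\<Sum>s\<in>S. smult (of_real (c s)) (F s)) = 0"
proof -
  have "card {Re, Im} \<le> 2" by (simp add: card_insert_if)
  then have "card ({..D} \<times> {Re, Im}) < card S"
    using card mult_le_mono2[of "card {Re, Im}" 2 "D + 1"] by (simp add: card_cartesian_product)
  then obtain c where c: "\<exists>s\<in>S. c s \<noteq> 0"
    "\<forall>e\<in>{..D} \<times> {Re, Im}. (\<Sum>s\<in>S. c s * snd e (coeff (F s) (fst e))) = 0"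
    using homogeneous_system_nontrivial_solution[of "{..D} \<times> {Re, Im}" S
        "\<lambda>s e. snd e (coeff (F s) (fst e))"] \<open>finite S\<close> by auto
  have "(\<Sum>s\<in>S. smult (of_real (c s)) (F s)) = 0"
  proof (rule poly_eqI)
    fix i
    show "coeff (\<Sum>s\<in>S. smult (of_real (c s)) (F s)) i = coeff 0 i"
    proof (cases "i \<le> D")
      case True
      then show ?thesis using c(2) by (auto simp: coeff_sum complex_eq_iff)
    next
      case False
      then have "coeff (F s) i = 0" if "s \<in> S" for s
        using deg[OF that] by (simp add: coeff_eq_0)
      then show ?thesis by (simp add: coeff_sum)
    qed
  qed
  then show thesis using that c(1) by blast
qed

section \<open>Evaluation of polynomials in three variables\<close>

lemma poly3_zero: "poly3 0 x y z = 0"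
  by (simp add: poly3_def)

lemma poly3_add: "poly3 (P + Q) x y z = poly3 P x y z + poly3 Q x y z"
proof -
  \<comment> \<open>Stated for an additive \<open>f\<close> because the maps nested in
    \<open>poly3\<close> are themselves evaluations.\<close>
  have map_add: "map_poly f (p + q) = map_poly f p + map_poly f q"
    if "f 0 = 0" "\<And>a b. f (a + b) = f a + f b"
    for f :: "'a :: comm_monoid_add \<Rightarrow> complex" and p q
    using that by (intro poly_eqI) (simp add: coeff_map_poly)
  show ?thesis unfolding poly3_def by (simp add: map_add)
qed

lemma poly3_sum: "poly3 (\<Sum>s\<in>S. P s) x y z = (\<Sum>s\<in>S. poly3 (P s) x y z)"
  by (induction S rule: infinite_finite_induct) (simp_all add: poly3_zero poly3_add)

lemma poly3_monom:
  "poly3 (monom (monom (monom c i) j) l) x y z = of_real c * x ^ i * y ^ j * z ^ l"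
  by (simp add: poly3_def map_poly_monom poly_monom)

section \<open>Rational parametrization of gauges and chain circles\<close>

text \<open>
  The inner variable of the following polynomials is \<open>t = (R - d)/r\<close>, the outer one is
  \<open>\<zeta> = e^(i\<theta>)\<close>; a factor \<open>h \<zeta>\<close> clears the denominators of \<open>R b\<close> and \<open>b z\<close>, and \<open>u\<close> stands
  for \<open>h R/r\<close>.
\<close>

definition gauge_denominator :: "real \<Rightarrow> complex poly" where
  "gauge_denominator q = [:- of_real (1 + 2 * q), 1:]"

definition curvature_poly :: "real \<Rightarrow> complex poly poly" where
  "curvature_poly q =
    (let h = gauge_denominator q; u = [:- 1 / 2, 0, 1 / 2:];
         c = smult (of_real (1 / (4 * q))) (u - [:0, 1:] * h)
     in [:c, smult (of_real (1 / (2 * q))) (u - h), c:])"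

definition weighted_centre_poly :: "real \<Rightarrow> real \<Rightarrow> complex poly poly" where
  "weighted_centre_poly q s =
    (let h = gauge_denominator q; u = [:- 1 / 2, 0, 1 / 2:];
         c = smult (of_real (1 / (4 * q))) (u - smult (of_real (1 + 2 * q)) h)
     in [:c - smult (of_real (s / 2)) h,
          smult (of_real (1 / (2 * q))) (u - [:0, 1:] * h),
          c + smult (of_real (s / 2)) h:])"

text \<open>Substituting \<open>d = R - t r\<close> cancels the terms \<open>R^2\<close>, and after
  division by \<open>r\<close> the gauge relation is linear in \<open>R\<close> and
  \<open>r\<close>.\<close>

lemma gauge_rational:
  fixes R r d q :: real
  assumes "0 < r" and "d\<^sup>2 = (R - r)\<^sup>2 - 4 * q * R * r"
  defines "t \<equiv> (R - d) / r"
  shows "(t\<^sup>2 - 1) / 2 = (t - 1 - 2 * q) * (R / r)"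
proof -
  have d: "d = R - t * r" using assms(1) by (simp add: t_def)
  have "r * (r * (t\<^sup>2 - 1)) = r * (2 * (t - 1 - 2 * q) * R)"
    using assms(2) unfolding d by (simp add: power2_eq_square algebra_simps)
  then have "r * (t\<^sup>2 - 1) = 2 * (t - 1 - 2 * q) * R"
    using assms(1) by simp
  then show ?thesis using assms(1) by (simp add: field_simps)
qed

text \<open>A zero would force \<open>t = 1\<close> or \<open>t = -1\<close>, hence
  \<open>d \<ge> R - r\<close>, whereas the gauge relation makes \<open>d\<close> smaller than
  \<open>R - r\<close>.\<close>

lemma gauge_denominator_nonzero:
  fixes R r d q :: real
  assumes pos: "0 < R" "0 < r" "0 < q" "0 < d" "r < R"
    and gauge: "d\<^sup>2 = (R - r)\<^sup>2 - 4 * q * R * r"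
  shows "poly (gauge_denominator q) (of_real ((R - d) / r)) \<noteq> 0"
proof
  define t where "t = (R - d) / r"
  assume "poly (gauge_denominator q) (of_real ((R - d) / r)) = 0"
  then have "complex_of_real (t - 1 - 2 * q) = 0"
    by (simp add: gauge_denominator_def t_def algebra_simps)
  then have "t - 1 - 2 * q = 0" by (simp only: of_real_eq_0_iff)
  then have "t\<^sup>2 = 1" using gauge_rational[OF pos(2) gauge] by (simp add: t_def)
  then have "t = 1 \<or> t = -1" by (simp add: power2_eq_1_iff)
  then have "d \<ge> R - r" using pos by (auto simp: t_def field_simps)
  then have "d\<^sup>2 \<ge> (R - r)\<^sup>2" using pos by (intro power_mono) auto
  moreover have "4 * q * R * r > 0" using pos by simp
  ultimately show False using gauge by linarith
qed

text \<open>On the unit circle \<open>2 C = \<zeta> + 1 / \<zeta>\<close> and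
  \<open>2 \<i> S = \<zeta> - 1 / \<zeta>\<close>, so expressions affine in \<open>C\<close> and
  \<open>S\<close> are Laurent polynomials of degree 1 in \<open>\<zeta>\<close>.\<close>

lemma chain_polys_eval:
  fixes R r d q s C S :: real and \<zeta> z :: complex
  assumes pos: "0 < R" "0 < r" "0 < q"
    and gauge: "d\<^sup>2 = (R - r)\<^sup>2 - 4 * q * R * r"
    and CS: "C\<^sup>2 + S\<^sup>2 = 1" and b: "b = (R - r + d * C) / (2 * q * r * R)"
    and x: "b * Re z = (d + (R - r - 2 * q * r) * C) / (2 * q * r)"
    and y: "b * Im z = s * S"
  defines "t \<equiv> complex_of_real ((R - d) / r)" and "\<zeta> \<equiv> Complex C S"
  shows "poly (poly (curvature_poly q) [:\<zeta>:]) t = \<zeta> * poly (gauge_denominator q) t * of_real (R * b)"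
    and "poly (poly (weighted_centre_poly q s) [:\<zeta>:]) t
      = \<zeta> * poly (gauge_denominator q) t * (of_real b * z)"
proof -
  define t' where "t' = (R - d) / r"
  define h where "h = t' - 1 - 2 * q"
  have t: "t = of_real t'" by (simp add: t_def t'_def)
  have hh: "poly (gauge_denominator q) t = of_real h"
    by (simp add: gauge_denominator_def t h_def algebra_simps)
  have "(t'\<^sup>2 - 1) / 2 = h * (R / r)"
    using gauge_rational[OF pos(2) gauge] by (simp add: t'_def h_def)
  moreover have "poly [:- 1 / 2, 0, 1 / 2:] t = complex_of_real ((t'\<^sup>2 - 1) / 2)"
    by (simp add: t power2_eq_square field_simps)
  ultimately have uu: "poly [:- 1 / 2, 0, 1 / 2:] t = complex_of_real (h * (R / r))"
    by simp
  have quadratic: "poly (poly [:a, b, c:] [:\<zeta>:]) t = poly a t + \<zeta> * poly b t + \<zeta>\<^sup>2 * poly c t"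
    for a b c by (simp add: power2_eq_square algebra_simps)
  have X: "poly [:0, 1:] t = of_real t'" by (simp add: t)
  note eval = quadratic poly_add poly_diff poly_mult poly_smult hh uu X
  \<comment> \<open>Hence \<open>u - t h\<close> in the coefficients stands for
    \<open>h d / r\<close>.\<close>
  have t'd: "t' = R / r - d / r" by (simp add: t'_def diff_divide_distrib)
  have \<zeta>C: "\<zeta>\<^sup>2 + 1 = 2 * \<zeta> * of_real C" "\<zeta>\<^sup>2 - 1 = 2 * \<zeta> * (\<i> * of_real S)"
    using CS by (auto simp: \<zeta>_def complex_eq_iff power2_eq_square algebra_simps)
  have "poly (poly (curvature_poly q) [:\<zeta>:]) t
      = of_real (1 / (4 * q) * (h * (R / r) - t' * h)) * (\<zeta>\<^sup>2 + 1)
        + of_real (1 / (2 * q) * (h * (R / r) - h)) * \<zeta>"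
    unfolding curvature_poly_def Let_def eval
    by (simp add: algebra_simps add_divide_distrib diff_divide_distrib)
  also have "\<dots> = \<zeta> * of_real h *
      of_real (1 / (2 * q) * (d / r) * C + 1 / (2 * q) * (R / r - 1))"
    unfolding \<zeta>C t'd by (simp add: algebra_simps)
  also have "1 / (2 * q) * (d / r) * C + 1 / (2 * q) * (R / r - 1) = R * b"
    using pos by (simp add: b field_simps)
  finally show "poly (poly (curvature_poly q) [:\<zeta>:]) t
      = \<zeta> * poly (gauge_denominator q) t * of_real (R * b)" unfolding hh .
  have "poly (poly (weighted_centre_poly q s) [:\<zeta>:]) t
      = of_real (1 / (4 * q) * (h * (R / r) - (1 + 2 * q) * h)) * (\<zeta>\<^sup>2 + 1)
        + of_real (s / 2 * h) * (\<zeta>\<^sup>2 - 1)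
        + of_real (1 / (2 * q) * (h * (R / r) - t' * h)) * \<zeta>"
    unfolding weighted_centre_poly_def Let_def eval
    by (simp add: algebra_simps add_divide_distrib diff_divide_distrib)
  also have "\<dots> = \<zeta> * of_real h *
      (of_real (1 / (2 * q) * (d / r) + 1 / (2 * q) * (R / r - (1 + 2 * q)) * C)
        + \<i> * of_real (s * S))"
    unfolding \<zeta>C t'd using pos(3) by (simp add: field_simps)
  also have "1 / (2 * q) * (d / r) + 1 / (2 * q) * (R / r - (1 + 2 * q)) * C = b * Re z"
    using pos by (simp add: x field_simps)
  also have "of_real (b * Re z) + \<i> * of_real (s * S) = of_real b * z"
    by (simp add: complex_eq_iff y)
  finally show "poly (poly (weighted_centre_poly q s) [:\<zeta>:]) t
      = \<zeta> * poly (gauge_denominator q) t * (of_real b * z)" unfolding hh .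
qed

section \<open>Equally spaced parameters of a Steiner chain\<close>

lemma tan_square_facts:
  fixes n :: nat
  assumes "3 \<le> n"
  defines "q \<equiv> (tan (pi / n))\<^sup>2" and "s \<equiv> 1 / sin (pi / n)"
  shows "0 < q" "0 < s" "s\<^sup>2 = (1 + q) / q" "(1 - q) / (1 + q) = cos (2 * pi / n)"
proof -
  define x where "x = pi / real n"
  have x: "0 < x" "x < pi / 2"
    using assms(1) by (auto simp: x_def field_simps)
  have sc: "0 < sin x" "0 < cos x"
    using x by (auto intro: sin_gt_zero cos_gt_zero)
  have q: "q = (sin x)\<^sup>2 / (cos x)\<^sup>2" by (simp add: q_def x_def[symmetric] tan_def power_divide)
  have one: "1 + q = 1 / (cos x)\<^sup>2"
    using sc sin_cos_squared_add[of x] by (simp add: q field_simps)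
  show "0 < q" using sc by (simp add: q)
  show "0 < s" using sc by (simp add: s_def x_def)
  show "s\<^sup>2 = (1 + q) / q" unfolding one using sc by (simp add: q s_def x_def[symmetric] power_divide)
  have "(1 - q) / (1 + q) = (cos x)\<^sup>2 - (sin x)\<^sup>2"
    unfolding one using sc by (simp add: q field_simps)
  also have "\<dots> = cos (2 * x)" by (simp add: cos_double)
  finally show "(1 - q) / (1 + q) = cos (2 * pi / n)" by (simp add: x_def)
qed

text \<open>Every circle of the chain has a parameter on the unit circle. Tangency of neighbours
  makes the parameters turn by \<plusminus>2\<pi>/n, and winding once makes them all turn the same
  way, so they form a geometric progression.\<close>

lemma chain_parametrization:
  fixes n :: nat and R r d :: real
  assumes n: "3 \<le> n" and gauge: "parent_gauge n R r d"
    and chain: "steiner_chain n (outer_parent R) (inner_parent r d) \<delta>"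
  defines "q \<equiv> (tan (pi / n))\<^sup>2" and "s \<equiv> 1 / sin (pi / n)"
    and "t \<equiv> complex_of_real ((R - d) / r)"
  obtains \<zeta>0 \<eta> where "\<zeta>0 \<noteq> 0" "\<eta> ^ n = 1" "\<And>j. 0 < j \<Longrightarrow> j < n \<Longrightarrow> \<eta> ^ j \<noteq> 1"
    and "\<And>i. i < n \<Longrightarrow> poly (poly (curvature_poly q) [:\<zeta>0 * \<eta> ^ i:]) t
      = \<zeta>0 * \<eta> ^ i * poly (gauge_denominator q) t * of_real (R * curvature (\<delta> i))"
    and "\<And>i. i < n \<Longrightarrow> poly (poly (weighted_centre_poly q s) [:\<zeta>0 * \<eta> ^ i:]) t
      = \<zeta>0 * \<eta> ^ i * poly (gauge_denominator q) t * (of_real (curvature (\<delta> i)) * centre (\<delta> i))"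
proof -
  note trig = tan_square_facts[OF n, folded q_def s_def]
  have pos: "0 < R" "0 < r" "0 < d" and g: "d\<^sup>2 = (R - r)\<^sup>2 - 4 * q * R * r"
    using gauge by (auto simp: parent_gauge_def q_def)
  define z where "z i = centre (\<delta> i)" for i
  define \<rho> where "\<rho> i = radius (\<delta> i)" for i
  have \<rho>: "0 < \<rho> i" "cmod (z i) = R - \<rho> i" "cmod (z i - of_real d) = \<rho> i + r"
    "cmod (z i - z (Suc i mod n)) = \<rho> i + \<rho> (Suc i mod n)" if "i < n" for i
    using chain that
    by (auto simp: steiner_chain_def externally_tangent_def internally_tangent_def
        outer_parent_def inner_parent_def dist_norm z_def \<rho>_def)
  have "\<exists>C S. C\<^sup>2 + S\<^sup>2 = 1
      \<and> 1 / \<rho> i = (R - r + d * C) / (2 * q * r * R)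
      \<and> 1 / \<rho> i * Re (z i) = (d + (R - r - 2 * q * r) * C) / (2 * q * r)
      \<and> 1 / \<rho> i * Im (z i) = s * S" if "i < n" for i
    using circle_between_parents[OF pos trig(1,2) \<rho>(1)[OF that] trig(3) g \<rho>(2,3)[OF that]]
    by metis
  then obtain C S where CS: "(C i)\<^sup>2 + (S i)\<^sup>2 = 1"
    "1 / \<rho> i = (R - r + d * C i) / (2 * q * r * R)"
    "1 / \<rho> i * Re (z i) = (d + (R - r - 2 * q * r) * C i) / (2 * q * r)"
    "1 / \<rho> i * Im (z i) = s * S i" if "i < n" for i
    by metis
  define \<zeta> where "\<zeta> i = Complex (C i) (S i)" for i
  \<comment> \<open>\<open>F\<close> recovers the centre, relative to that of \<gamma>, as
    \<open>b z\<close> divided by \<open>b\<close>. It depends on the parameter alone, so equal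
    parameters give equal centres.\<close>
  define F where "F w = Complex ((d + (R - r - 2 * q * r) * Re w) / (2 * q * r)) (s * Im w)
    / of_real ((R - r + d * Re w) / (2 * q * r * R)) - of_real d" for w
  have F: "F (\<zeta> i) = z i - of_real d" if "i < n" for i
  proof -
    have "F (\<zeta> i) = (of_real (1 / \<rho> i) * z i) / of_real (1 / \<rho> i) - of_real d"
      unfolding F_def \<zeta>_def complex.sel CS(2-4)[OF that, symmetric]
      by (simp add: complex_eq_iff)
    then show ?thesis using \<rho>(1)[OF that] by simp
  qed
  have unit: "cmod (\<zeta> i) = 1" if "i < n" for i
    using CS(1)[OF that] by (simp add: \<zeta>_def cmod_def)
  have step: "Re (\<zeta> (Suc i mod n) * cnj (\<zeta> i)) = cos (2 * pi / n)" if "i < n" for i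
  proof -
    have j: "Suc i mod n < n" using that by simp
    have "C i * C (Suc i mod n) + S i * S (Suc i mod n) = (1 - q) / (1 + q)"
      by (rule tangent_circles_angle[OF pos(1,2) trig(1) \<rho>(1)[OF that] \<rho>(1)[OF j] trig(3) g
          \<rho>(2)[OF that] \<rho>(2)[OF j] \<rho>(4)[OF that] CS(2)[OF that] CS(2)[OF j]
          CS(3)[OF that] CS(3)[OF j] CS(4)[OF that] CS(4)[OF j]])
    then show ?thesis unfolding trig(4) by (simp add: \<zeta>_def mult.commute)
  qed
  have nonzero: "F (\<zeta> i) \<noteq> 0" if "i < n" for i
    using \<rho>(1,3)[OF that] pos(2) F[OF that] by auto
  \<comment> \<open>Neighbouring centres in opposite directions from the centre of \<gamma> would be
    \<open>2 r\<close> farther apart than tangency allows.\<close>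
  have not_opposite: "Arg (F (\<zeta> (Suc i mod n)) / F (\<zeta> i)) \<noteq> pi" if "i < n" for i
  proof
    have j: "Suc i mod n < n" using that by simp
    assume "Arg (F (\<zeta> (Suc i mod n)) / F (\<zeta> i)) = pi"
    from Arg_eq_pi_imp_norm_diff[OF this nonzero[OF that]]
    have "cmod (z (Suc i mod n) - z i) = (\<rho> (Suc i mod n) + r) + (\<rho> i + r)"
      unfolding F[OF that] F[OF j] \<rho>(3)[OF that] \<rho>(3)[OF j] by simp
    then show False using \<rho>(4)[OF that] pos(2) by (simp add: norm_minus_commute)
  qed
  have "(\<Sum>i<n. Arg (F (\<zeta> (Suc i mod n)) / F (\<zeta> i)))
      = (\<Sum>i<n. Arg ((z (Suc i mod n) - of_real d) / (z i - of_real d)))"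
    by (intro sum.cong) (simp_all add: F)
  also have "\<dots> \<noteq> 0"
    using chain by (auto simp: steiner_chain_def winds_once_around_def inner_parent_def z_def)
  finally obtain \<eta> where \<eta>: "\<eta> ^ n = 1" "\<And>j. 0 < j \<Longrightarrow> j < n \<Longrightarrow> \<eta> ^ j \<noteq> 1"
    "\<And>i. i < n \<Longrightarrow> \<zeta> i = \<zeta> 0 * \<eta> ^ i"
    using walk_around_roots_of_unity[where \<zeta> = \<zeta> and F = F, OF n unit step not_opposite] by blast
  have "\<zeta> 0 \<noteq> 0" using unit[of 0] n by auto
  moreover have "poly (poly (curvature_poly q) [:\<zeta> 0 * \<eta> ^ i:]) t
      = \<zeta> 0 * \<eta> ^ i * poly (gauge_denominator q) t * of_real (R * curvature (\<delta> i))"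
    and "poly (poly (weighted_centre_poly q s) [:\<zeta> 0 * \<eta> ^ i:]) t
      = \<zeta> 0 * \<eta> ^ i * poly (gauge_denominator q) t * (of_real (curvature (\<delta> i)) * centre (\<delta> i))"
    if "i < n" for i
    using chain_polys_eval[OF pos(1,2) trig(1) g CS[OF that]] \<eta>(3)[OF that]
    by (simp_all only: t_def \<zeta>_def curvature_def z_def \<rho>_def)
  ultimately show thesis using that \<eta>(1,2) by blast
qed

section \<open>Moments as polynomials in \<open>t\<close>\<close>

lemma degree_quadratic_le: "degree [:a, b, c:] \<le> 2"
  by simp

text \<open>Equally spaced parameters reduce the sum over the chain to \<open>n\<close> times one
  coefficient, which involves only \<open>t\<close>. Since \<open>p\<close> is chosen before the
  gauge and the chain, this includes the invariance of the moment.\<close>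

lemma moment_eq_poly:
  fixes n k m :: nat
  assumes n: "3 \<le> n" and m: "m \<le> k" and k: "k < n"
  defines "h \<equiv> gauge_denominator ((tan (pi / n))\<^sup>2)"
  obtains p :: "complex poly" where
    "\<And>R r d \<delta>. parent_gauge n R r d \<Longrightarrow>
      steiner_chain n (outer_parent R) (inner_parent r d) \<delta> \<Longrightarrow>
      complex_moment n k m \<delta> * of_real R ^ (k - m) * poly h (of_real ((R - d) / r)) ^ k
        = poly p (of_real ((R - d) / r))"
proof -
  define q where "q = (tan (pi / n))\<^sup>2"
  define s where "s = 1 / sin (pi / n)"
  \<comment> \<open>At a chain circle \<open>Q\<close> takes the value
    \<open>(h \<zeta>)^k R^(k - m) b^k z^m\<close>; division by \<open>\<zeta>^k\<close> makes its
    coefficient at \<open>k\<close> the constant one.\<close>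
  define Q where "Q = curvature_poly q ^ (k - m) * weighted_centre_poly q s ^ m"
  have "degree Q \<le> 2 * (k - m) + 2 * m"
  proof -
    have "degree (curvature_poly q) \<le> 2" "degree (weighted_centre_poly q s) \<le> 2"
      unfolding curvature_poly_def weighted_centre_poly_def Let_def by (rule degree_quadratic_le)+
    then have "degree (curvature_poly q ^ (k - m)) \<le> 2 * (k - m)"
      "degree (weighted_centre_poly q s ^ m) \<le> 2 * m"
      using degree_power_le mult_le_mono1 order_trans by blast+
    then show ?thesis unfolding Q_def using degree_mult_le order_trans add_mono by meson
  qed
  then have deg: "degree Q \<le> 2 * k" using m by simp
  have "complex_moment n k m \<delta> * of_real R ^ (k - m) * poly h (of_real ((R - d) / r)) ^ k
        = poly (smult (of_nat n) (coeff Q k)) (of_real ((R - d) / r))"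
    if gauge: "parent_gauge n R r d"
      and chain: "steiner_chain n (outer_parent R) (inner_parent r d) \<delta>" for R r d \<delta>
  proof -
    define t where "t = complex_of_real ((R - d) / r)"
    define H where "H = poly h t"
    obtain \<zeta>0 \<eta> where \<zeta>: "\<zeta>0 \<noteq> 0" "\<eta> ^ n = 1" "\<And>j. 0 < j \<Longrightarrow> j < n \<Longrightarrow> \<eta> ^ j \<noteq> 1"
      and ev: "\<And>i. i < n \<Longrightarrow> poly (poly (curvature_poly q) [:\<zeta>0 * \<eta> ^ i:]) t
        = \<zeta>0 * \<eta> ^ i * H * of_real (R * curvature (\<delta> i))"
        "\<And>i. i < n \<Longrightarrow> poly (poly (weighted_centre_poly q s) [:\<zeta>0 * \<eta> ^ i:]) t
        = \<zeta>0 * \<eta> ^ i * H * (of_real (curvature (\<delta> i)) * centre (\<delta> i))"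
      using chain_parametrization[OF n gauge chain] unfolding q_def s_def t_def h_def H_def by metis
    have \<eta>0: "\<eta> \<noteq> 0" using \<zeta>(2) n by (cases "\<eta> = 0") (auto simp: power_0_left)
    have "of_real (curvature (\<delta> i)) ^ k * centre (\<delta> i) ^ m * of_real R ^ (k - m) * H ^ k
        = (\<Sum>a\<le>2 * k. poly (coeff Q a) t * ((\<zeta>0 * \<eta> ^ i) ^ a / (\<zeta>0 * \<eta> ^ i) ^ k))"
      if "i < n" for i
    proof -
      define \<xi> where "\<xi> = \<zeta>0 * \<eta> ^ i"
      define b where "b = complex_of_real (curvature (\<delta> i))"
      have "\<xi> \<noteq> 0" using \<zeta>(1) \<eta>0 by (simp add: \<xi>_def)
      have split: "x ^ k = x ^ (k - m) * x ^ m" for x :: complex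
        using m by (simp flip: power_add)
      have "poly (poly Q [:\<xi>:]) t
          = (\<xi> * H * (of_real R * b)) ^ (k - m) * (\<xi> * H * (b * centre (\<delta> i))) ^ m"
        using ev[OF that] by (simp add: Q_def \<xi>_def b_def poly_power)
      also have "\<dots> = \<xi> ^ k * (b ^ k * centre (\<delta> i) ^ m * of_real R ^ (k - m) * H ^ k)"
        unfolding split by (simp add: power_mult_distrib mult_ac)
      finally have "b ^ k * centre (\<delta> i) ^ m * of_real R ^ (k - m) * H ^ k
          = poly (poly Q [:\<xi>:]) t / \<xi> ^ k"
        using \<open>\<xi> \<noteq> 0\<close> by simp
      also have "poly (poly Q [:\<xi>:]) t = (\<Sum>a\<le>degree Q. poly (coeff Q a) t * \<xi> ^ a)"
        by (simp add: poly_altdef[of Q] poly_sum poly_power)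
      also have "\<dots> = (\<Sum>a\<le>2 * k. poly (coeff Q a) t * \<xi> ^ a)"
        using deg by (intro sum.mono_neutral_left) (auto simp: coeff_eq_0)
      finally show ?thesis by (simp add: \<xi>_def b_def sum_divide_distrib)
    qed
    then have "complex_moment n k m \<delta> * of_real R ^ (k - m) * H ^ k
        = (\<Sum>i<n. \<Sum>a\<le>2 * k. poly (coeff Q a) t * ((\<zeta>0 * \<eta> ^ i) ^ a / (\<zeta>0 * \<eta> ^ i) ^ k))"
      by (simp add: complex_moment_def sum_distrib_right)
    also have "\<dots> = (\<Sum>a\<le>2 * k. poly (coeff Q a) t *
        (\<Sum>i<n. (\<zeta>0 * \<eta> ^ i) ^ a / (\<zeta>0 * \<eta> ^ i) ^ k))"
      by (subst sum.swap) (simp add: sum_distrib_left)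
    \<comment> \<open>The assumption \<open>k < n\<close> keeps every exponent \<open>a - k\<close>
      strictly between \<open>-n\<close> and \<open>n\<close>.\<close>
    also have "\<dots> = (\<Sum>a\<le>2 * k. poly (coeff Q a) t * (if a = k then of_nat n else 0))"
      using sum_laurent_roots_of_unity[OF \<zeta>(2,3,1) k] by (intro sum.cong) simp_all
    also have "\<dots> = of_nat n * poly (coeff Q k) t"
      by (simp add: if_distrib[of "\<lambda>x. _ * x"] sum.delta cong: if_cong)
    finally show ?thesis by (simp add: t_def H_def)
  qed
  then show thesis using that by blast
qed

section \<open>Algebraic dependence by counting monomials\<close>

text \<open>With weights 1, 2 and \<open>k - m\<close> for \<open>x\<close>, \<open>y\<close> and
  \<open>z\<close>, all monomials used have weight \<open>W\<close>, so the same power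
  \<open>T^W\<close> clears \<open>T\<close> from each of them. What remains are
  \<open>(N + 1)^2\<close> polynomials in \<open>\<tau>\<close> of degree at most
  \<open>K N\<close>.\<close>

lemma weighted_relation:
  fixes p1 p2 p h :: "complex poly" and k m :: nat
  assumes "m \<le> k"
  obtains P :: "real poly poly poly" where "P \<noteq> 0"
    and "\<And>x y z T H \<tau>. H = poly h \<tau> \<Longrightarrow> H \<noteq> 0 \<Longrightarrow> T \<noteq> 0 \<Longrightarrow> x * T * H = poly p1 \<tau> \<Longrightarrow>
      y * T ^ 2 * H ^ 2 = poly p2 \<tau> \<Longrightarrow> z * T ^ (k - m) * H ^ k = poly p \<tau> \<Longrightarrow> poly3 P x y z = 0"
proof -
  define E where "E = degree p1 + degree p2 + degree p + degree h"
  \<comment> \<open>The four summands of \<open>K\<close> bound the degrees of the four factors of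
    \<open>F\<close>, divided by \<open>N\<close>.\<close>
  define K where "K = (2 + k) * E + E + E + (2 + 2 * k) * E"
  \<comment> \<open>This choice gives \<open>2 (K N + 1) = N^2 - N + 2 < (N + 1)^2\<close>.\<close>
  define N where "N = 2 * K + 1"
  \<comment> \<open>\<open>W\<close> is large enough that the subtraction in \<open>ex\<close> never
    truncates.\<close>
  define W where "W = (2 + k) * N"
  \<comment> \<open>A monomial absorbs \<open>H\<close> to the power \<open>W + m l\<close>, which
    depends on \<open>l\<close>; a power of \<open>h\<close> in \<open>F\<close> pads it to the
    common exponent \<open>M\<close>.\<close>
  define M where "M = W + k * N"
  define ex where "ex j l = W - 2 * j - (k - m) * l" for j l
  define F where "F = (\<lambda>(j, l). p1 ^ ex j l * p2 ^ j * p ^ l * h ^ (M - (W + m * l)))"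
  define S where "S = {..N} \<times> {..N}"
  have ex: "ex j l + 2 * j + (k - m) * l = W" if "j \<le> N" "l \<le> N" for j l
  proof -
    have "(k - m) * l \<le> k * N" using that by (intro mult_le_mono) auto
    then have "2 * j + (k - m) * l \<le> W" using that by (simp add: W_def)
    then show ?thesis by (simp add: ex_def)
  qed
  have deg: "degree (F s) \<le> K * N" if "s \<in> S" for s
  proof -
    obtain j l where s: "s = (j, l)" "j \<le> N" "l \<le> N"
      using \<open>s \<in> S\<close> by (auto simp: S_def)
    have pow: "degree (f ^ i) \<le> E * i'" if "degree f \<le> E" "i \<le> i'" for f :: "complex poly" and i i'
      using degree_power_le[of f i] mult_le_mono[OF that] by linarith
    have "degree (p1 ^ ex j l) \<le> E * W" "degree (p2 ^ j) \<le> E * N" "degree (p ^ l) \<le> E * N"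
      "degree (h ^ (M - (W + m * l))) \<le> E * M"
      by (rule pow; use s in \<open>simp add: E_def ex_def\<close>)+
    then have "degree (F s) \<le> E * W + E * N + E * N + E * M"
      unfolding F_def s(1) prod.case
      using degree_mult_le order_trans add_mono by meson
    also have "\<dots> = K * N" by (simp add: K_def W_def M_def algebra_simps)
    finally show ?thesis .
  qed
  have "2 * (K * N + 1) < card S"
    by (simp add: S_def card_cartesian_product N_def algebra_simps)
  then obtain c where c: "\<exists>s\<in>S. c s \<noteq> 0" "(\<Sum>s\<in>S. smult (of_real (c s)) (F s)) = 0"
    using real_linear_relation_complex_polys[of S F "K * N"] deg by (auto simp: S_def)
  define P where "P = (\<Sum>(j, l)\<in>S. monom (monom (monom (c (j, l)) (ex j l)) j) l)"
  have "P \<noteq> 0"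
  proof
    assume "P = 0"
    obtain j l where jl: "(j, l) \<in> S" "c (j, l) \<noteq> 0" using c(1) by auto
    \<comment> \<open>Distinct pairs \<open>(j, l)\<close> give distinct monomials, so nothing
      cancels.\<close>
    have "coeff (coeff (coeff P l) j) (ex j l)
        = (\<Sum>s\<in>S. if s = (j, l) then c (j, l) else 0)"
      unfolding P_def coeff_sum
      by (intro sum.cong) (auto simp: coeff_monom split: if_splits)
    also have "\<dots> = c (j, l)" using jl(1) by (simp add: S_def)
    finally show False using jl(2) \<open>P = 0\<close> by simp
  qed
  moreover have "poly3 P x y z = 0"
    if H: "H = poly h \<tau>" "H \<noteq> 0" "T \<noteq> 0" and x: "x * T * H = poly p1 \<tau>"
      and y: "y * T ^ 2 * H ^ 2 = poly p2 \<tau>" and z: "z * T ^ (k - m) * H ^ k = poly p \<tau>"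
    for x y z T H \<tau>
  proof -
    have "x ^ ex j l * y ^ j * z ^ l * (T ^ W * H ^ M) = poly (F (j, l)) \<tau>"
      if "j \<le> N" "l \<le> N" for j l
    proof -
      have "k * l = (k - m) * l + m * l"
        using assms by (metis add_mult_distrib le_add_diff_inverse2)
      then have kl: "ex j l + 2 * j + k * l = W + m * l" using ex[OF that] by linarith
      have "m * l \<le> k * N" using assms that by (intro mult_le_mono) auto
      then have "ex j l + 2 * j + k * l + (M - (W + m * l)) = M" unfolding kl M_def by linarith
      from arg_cong[OF this, of "\<lambda>i. H ^ i"]
      have HM: "H ^ ex j l * (H\<^sup>2) ^ j * (H ^ k) ^ l * H ^ (M - (W + m * l)) = H ^ M"
        by (simp only: power_add power_mult)
      from arg_cong[OF ex[OF that], of "\<lambda>i. T ^ i"]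
      have TW: "T ^ ex j l * (T\<^sup>2) ^ j * (T ^ (k - m)) ^ l = T ^ W"
        by (simp only: power_add power_mult)
      show ?thesis
        unfolding HM[symmetric] TW[symmetric] F_def prod.case poly_mult poly_power
          x[symmetric] y[symmetric] z[symmetric] H(1)[symmetric] power_mult_distrib
        by (simp only: mult_ac)
    qed
    then have "poly3 P x y z * (T ^ W * H ^ M) = (\<Sum>s\<in>S. of_real (c s) * poly (F s) \<tau>)"
      unfolding P_def poly3_sum sum_distrib_right
      by (intro sum.cong) (auto simp: poly3_monom S_def mult.assoc)
    also have "\<dots> = poly (\<Sum>s\<in>S. smult (of_real (c s)) (F s)) \<tau>" by (simp add: poly_sum)
    finally show ?thesis using c(2) H by simp
  qed
  ultimately show thesis using that by blast
qed

theorem theorem6: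
  fixes n k m :: nat
  assumes "3 \<le> n" and "m \<le> k" and "k \<le> n - 1"
  shows "\<exists>P :: real poly poly poly. P \<noteq> 0 \<and>
    (\<forall>R r d :: real. parent_gauge n R r d \<longrightarrow>
      (\<forall>\<delta>. steiner_chain n (outer_parent R) (inner_parent r d) \<delta> \<longrightarrow>
        poly3 P (bending_moment n 1 \<delta>) (bending_moment n 2 \<delta>) (complex_moment n k m \<delta>) = 0))"
proof -
  define q where "q = (tan (pi / n))\<^sup>2"
  define h where "h = gauge_denominator q"
  \<comment> \<open>\<open>2 < n\<close> brings both bending moments within the range of
    \<open>moment_eq_poly\<close>.\<close>
  have lt: "1 < n" "2 < n" "k < n" using assms by auto
  obtain p1 where p1: "\<And>R r d \<delta>. parent_gauge n R r d \<Longrightarrow>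
      steiner_chain n (outer_parent R) (inner_parent r d) \<delta> \<Longrightarrow>
      complex_moment n 1 0 \<delta> * of_real R ^ (1 - 0) * poly h (of_real ((R - d) / r)) ^ 1
        = poly p1 (of_real ((R - d) / r))"
    using moment_eq_poly[OF assms(1) _ lt(1), of 0] unfolding h_def q_def by blast
  obtain p2 where p2: "\<And>R r d \<delta>. parent_gauge n R r d \<Longrightarrow>
      steiner_chain n (outer_parent R) (inner_parent r d) \<delta> \<Longrightarrow>
      complex_moment n 2 0 \<delta> * of_real R ^ (2 - 0) * poly h (of_real ((R - d) / r)) ^ 2
        = poly p2 (of_real ((R - d) / r))"
    using moment_eq_poly[OF assms(1) _ lt(2), of 0] unfolding h_def q_def by blast
  obtain p where p: "\<And>R r d \<delta>. parent_gauge n R r d \<Longrightarrow>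
      steiner_chain n (outer_parent R) (inner_parent r d) \<delta> \<Longrightarrow>
      complex_moment n k m \<delta> * of_real R ^ (k - m) * poly h (of_real ((R - d) / r)) ^ k
        = poly p (of_real ((R - d) / r))"
    using moment_eq_poly[OF assms(1,2) lt(3)] unfolding h_def q_def by blast
  obtain P where P: "P \<noteq> 0"
    "\<And>x y z T H \<tau>. H = poly h \<tau> \<Longrightarrow> H \<noteq> 0 \<Longrightarrow> T \<noteq> 0 \<Longrightarrow> x * T * H = poly p1 \<tau> \<Longrightarrow>
      y * T ^ 2 * H ^ 2 = poly p2 \<tau> \<Longrightarrow> z * T ^ (k - m) * H ^ k = poly p \<tau> \<Longrightarrow> poly3 P x y z = 0"
    using weighted_relation[OF assms(2)] by blast
  have "poly3 P (bending_moment n 1 \<delta>) (bending_moment n 2 \<delta>) (complex_moment n k m \<delta>) = 0"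
    if gauge: "parent_gauge n R r d"
      and chain: "steiner_chain n (outer_parent R) (inner_parent r d) \<delta>" for R r d \<delta>
  \<comment> \<open>The relation is applied with \<open>T\<close> equal to \<open>R\<close>,
    \<open>\<tau>\<close> equal to \<open>(R - d) / r\<close>, and \<open>H\<close> the value of
    \<open>h\<close> there.\<close>
  proof (rule P(2)[OF refl])
    have "0 < R" "0 < r" "0 < d" "r < R" "d\<^sup>2 = (R - r)\<^sup>2 - 4 * q * R * r"
      using gauge by (auto simp: parent_gauge_def q_def)
    then show "poly h (of_real ((R - d) / r)) \<noteq> 0" "complex_of_real R \<noteq> 0"
      using gauge_denominator_nonzero tan_square_facts(1)[OF assms(1)]
      unfolding h_def q_def by auto
  qed (use p1[OF gauge chain] p2[OF gauge chain] p[OF gauge chain] in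
      \<open>simp_all only: bending_moment_def power_one_right diff_zero\<close>)
  then show ?thesis using P(1) by blast
qed

end
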